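(* Let $I=[0,1]$ denote the unit interval with its usual metric. (1) If $A,B\subseteq I$ are finite subsets with $A\subseteq B$, then $|A|_{\mathrm{Rips}}\le|B|_{\mathrm{Rips}}$. (2) For any $t\in(0,\infty)$ we have $$\sup_{A\subseteq I,\ A\text{ finite}}|tA|_{\mathrm{Rips}}=1+t,$$ and indeed $$\lim_{A\to I,\ A\text{ finite}}|tA|_{\mathrm{Rips}}=1+t$$ with uniform convergence on compact subsets of $(0,\infty)$; that is, for every compact $K\subseteq(0,\infty)$ and every $\varepsilon>0$ there is $\delta>0$ such that for every finite $A\subseteq I$ with $d_H(A,I)<\delta$ we have $\bigl||tA|_{\mathrm{Rips}}-(1+t)\bigr|<\varepsilon$ for all $t\in K$.
   Context: $d_H$ denotes the Hausdorff distance, and $A\to I$ means convergence in the Hausdorff metric; subsets of $I$ carry the induced metric. For a finite metric space $X$, the Rips magnitude function $|tX|_{\mathrm{Rips}}$ is the persistent magnitude function of the persistent homology of its Vietoris–Rips complex; equivalently, it is given for $t\in(0,\infty)$ by $|tX|_{\mathrm{Rips}}=\sum_{\emptyset\ne A\subseteq X}(-1)^{\#A-1}e^{-\mathrm{diam}(A)t}$, and $|X|_{\mathrm{Rips}}$ is its value at $t=1$. *)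

theory Defs
  imports "HOL-Analysis.Analysis"
begin

(* The Rips magnitude function t |-> |tX|_Rips of a finite metric space X. A nonempty
   A <= X is a simplex of dimension card A - 1 that enters the Vietoris-Rips filtration
   of X at parameter diam A and never leaves; by the Euler-Poincare formula the persistent
   magnitude of the Rips homology is therefore this alternating sum. For infinite X the
   sum is the junk value 0. *)
definition rips_magnitude_fun :: "'a::metric_space set \<Rightarrow> real \<Rightarrow> real" where
  "rips_magnitude_fun X t =
     (\<Sum>A | A \<noteq> {} \<and> A \<subseteq> X. (-1) ^ (card A - 1) * exp (- diameter A * t))"

definition rips_magnitude :: "'a::metric_space set \<Rightarrow> real" where
  "rips_magnitude X = rips_magnitude_fun X 1"

(* The values are in [0, \<infinity>], so that the distance from the empty set to
   a nonempty set is \<infinity>. *)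
definition hausdorff_dist :: "'a::metric_space set \<Rightarrow> 'a set \<Rightarrow> ennreal" where
  "hausdorff_dist A B =
     max (SUP a\<in>A. INF b\<in>B. ennreal (dist a b)) (SUP b\<in>B. INF a\<in>A. ennreal (dist a b))"

(* The filter of "A \<rightarrow> S with A a finite subset of S" in the Hausdorff metric. *)
definition finite_subsets_to :: "'a::metric_space set \<Rightarrow> 'a set filter" where
  "finite_subsets_to S =
     (INF \<delta>\<in>{0::real<..}.
        principal {A. finite A \<and> A \<subseteq> S \<and> hausdorff_dist A S < ennreal \<delta>})"

end

theory Submission
  imports Defs
begin

text \<open>Pairing the subsets of an initial segment that do and do not contain its
  maximum shows that adjoining a new maximum \<open>b\<close> to a finite set with maximum \<open>m\<close>
  changes the Rips magnitude function by \<open>1 - exp (- (b - m) t)\<close>. So a set with consecutive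
  gaps \<open>d\<^sub>i\<close> has magnitude \<open>1 + (\<Sum>i. 1 - exp (- d\<^sub>i t))\<close>. Monotonicity is then
  subadditivity of \<open>x \<mapsto> 1 - exp (- x t)\<close>, and \<open>x - x\<^sup>2 \<le> 1 - exp (- x) \<le> x\<close> bounds the
  magnitude in terms of the total length and the largest gap.\<close>

section \<open>Diameters and extreme points of finite sets of reals\<close>

lemma diameter_finite_real:
  fixes A :: "real set"
  assumes "finite A" "A \<noteq> {}"
  shows "diameter A = Max A - Min A"
proof (rule antisym)
  show "diameter A \<le> Max A - Min A"
  proof (rule diameter_le)
    show "A \<noteq> {} \<or> 0 \<le> Max A - Min A" using assms by simp
    fix x y assume "x \<in> A" "y \<in> A"
    then have "Min A \<le> x" "x \<le> Max A" "Min A \<le> y" "y \<le> Max A" using assms by auto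
    then show "norm (x - y) \<le> Max A - Min A" by auto
  qed
  have "dist (Max A) (Min A) \<le> diameter A"
    using assms by (intro diameter_bounded_bound finite_imp_bounded) auto
  then show "Max A - Min A \<le> diameter A" by (simp add: dist_real_def)
qed

lemma Max_insert_greatest:
  fixes A :: "'a::linorder set"
  assumes "finite A" "\<And>a. a \<in> A \<Longrightarrow> a < b"
  shows "Max (insert b A) = b"
  using assms by (intro Max_eqI) (auto simp: less_imp_le)

lemma Min_insert_greatest:
  fixes A :: "'a::linorder set"
  assumes "finite A" "A \<noteq> {}" "\<And>a. a \<in> A \<Longrightarrow> a < b"
  shows "Min (insert b A) = Min A"
proof -
  have "Min A < b" using assms by (metis Min_in)
  then show ?thesis using assms(1,2) by (simp add: less_imp_le min.absorb2 del: Min_le_iff)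
qed

section \<open>The change of the magnitude when a point is adjoined\<close>

lemma sum_Pow_insert:
  fixes f :: "'a set \<Rightarrow> 'b::comm_monoid_add"
  assumes "finite A" "x \<notin> A"
  shows "(\<Sum>S\<in>Pow (insert x A). f S) = (\<Sum>S\<in>Pow A. f S) + (\<Sum>S\<in>Pow A. f (insert x S))"
proof -
  have "inj_on (insert x) (Pow A)" using assms(2) by (auto simp: inj_on_def)
  moreover have "Pow A \<inter> insert x ` Pow A = {}" using assms(2) by auto
  ultimately show ?thesis
    using assms(1) by (simp add: Pow_insert sum.union_disjoint sum.reindex)
qed

lemma rips_magnitude_fun_empty [simp]: "rips_magnitude_fun {} t = 0"
proof -
  have "{A. A \<noteq> {} \<and> A \<subseteq> ({} :: 'a set)} = {}" by auto
  then show ?thesis by (simp only: rips_magnitude_fun_def sum.empty)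
qed

lemma rips_magnitude_fun_insert:
  assumes "finite A" "x \<notin> A"
  shows "rips_magnitude_fun (insert x A) t = rips_magnitude_fun A t
    + (\<Sum>T\<in>Pow A. (-1) ^ card T * exp (- diameter (insert x T) * t))"
proof -
  \<comment> \<open>Extending the summand by 0 to the empty set turns the sum into one over a full
    power set, which \<open>sum_Pow_insert\<close> can split. The unmodified formula would
    contribute a spurious 1 there, since truncated subtraction makes the exponent 0 and
    \<open>diameter {}\<close> is 0.\<close>
  define f where
    "f S = (if S = {} then 0 else (-1) ^ (card S - 1) * exp (- diameter S * t))" for S :: "'a set"
  have f: "rips_magnitude_fun B t = (\<Sum>S\<in>Pow B. f S)" if "finite B" for B
    unfolding rips_magnitude_fun_def f_def using that
    by (intro sum.mono_neutral_cong_left) auto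
  have "f (insert x T) = (-1) ^ card T * exp (- diameter (insert x T) * t)" if "T \<in> Pow A" for T
  proof -
    have "finite T" "x \<notin> T" using that assms finite_subset by auto
    then show ?thesis by (simp add: f_def)
  qed
  then show ?thesis using assms by (simp add: f sum_Pow_insert)
qed

lemma rips_magnitude_fun_singleton [simp]: "rips_magnitude_fun {x} t = 1"
  by (simp add: rips_magnitude_fun_insert)

text \<open>The new simplices are the sets \<open>insert b T\<close> with \<open>T\<close> a subset
  of \<open>A\<close>. Toggling \<open>m = Max A\<close> in \<open>T\<close> flips the sign; if
  \<open>T\<close> has a point other than \<open>m\<close>, it also preserves the diameter, because
  neither the greatest element \<open>b\<close> nor the least element changes. All such pairs
  cancel.\<close>

lemma rips_magnitude_fun_insert_greatest:
  fixes A :: "real set"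
  assumes A: "finite A" "A \<noteq> {}" and b: "\<And>a. a \<in> A \<Longrightarrow> a < b"
  shows "rips_magnitude_fun (insert b A) t
    = rips_magnitude_fun A t + (1 - exp (- (b - Max A) * t))"
proof -
  define m C where "m = Max A" and "C = A - {m}"
  have m: "m \<in> A" "m < b" using A b by (auto simp: m_def)
  have AC: "A = insert m C" "m \<notin> C" "finite C" using A m by (auto simp: C_def)
  have Cm: "c < m" if "c \<in> C" for c
    using that A Max_ge[of A c] by (auto simp: C_def m_def order.strict_iff_order)
  define g where "g T = (-1) ^ card T * exp (- diameter (insert b T) * t)" for T
  have g: "g T + g (insert m T) = 0" if "T \<in> Pow C - {{}}" for T
  proof -
    have T: "finite T" "T \<noteq> {}" "m \<notin> T" "T \<subseteq> C" using that AC finite_subset by auto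
    have Tm: "c < m" if "c \<in> T" for c using that T Cm by auto
    have Tb: "c < b" if "c \<in> insert m T" for c using that Tm m(2) by (auto intro: less_trans)
    have "diameter (insert b (insert m T)) = b - Min T"
      using T Tm Tb by (simp only: diameter_finite_real Max_insert_greatest Min_insert_greatest
        finite_insert insert_not_empty simp_thms)
    also have "\<dots> = diameter (insert b T)"
      using T Tb by (simp only: diameter_finite_real Max_insert_greatest Min_insert_greatest
        finite_insert insert_not_empty simp_thms insert_iff)
    finally have "diameter (insert b (insert m T)) = diameter (insert b T)" .
    then show ?thesis using T by (simp add: g_def)
  qed
  have "b \<notin> A" using b by auto
  then have "rips_magnitude_fun (insert b A) t = rips_magnitude_fun A t + (\<Sum>T\<in>Pow A. g T)"
    using A by (simp add: rips_magnitude_fun_insert g_def)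
  also have "(\<Sum>T\<in>Pow A. g T) = (\<Sum>T\<in>Pow C. g T + g (insert m T))"
    using AC by (simp add: sum_Pow_insert sum.distrib)
  \<comment> \<open>The one surviving pair consists of \<open>{b}\<close>, of diameter 0, and
    \<open>{m, b}\<close>, of diameter \<open>b - m\<close>.\<close>
  also have "\<dots> = (\<Sum>T\<in>{{}}. g T + g (insert m T))"
    using g AC by (intro sum.mono_neutral_right) auto
  also have "\<dots> = 1 - exp (- (b - m) * t)"
    using m by (simp add: g_def diameter_finite_real max_def min_def)
  finally show ?thesis by (simp add: m_def)
qed

section \<open>Monotonicity under inclusion\<close>

lemma rips_magnitude_fun_le_insert_greatest:
  fixes A :: "real set"
  assumes "finite A" "\<And>a. a \<in> A \<Longrightarrow> a < b" "t \<ge> 0"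
  shows "rips_magnitude_fun A t \<le> rips_magnitude_fun (insert b A) t"
proof (cases "A = {}")
  case False
  then have "Max A < b" using assms by simp
  then have "0 \<le> (b - Max A) * t" using assms by simp
  then have "exp (- (b - Max A) * t) \<le> 1" by (simp only: exp_le_one_iff mult_minus_left neg_le_0_iff_le)
  then show ?thesis using assms False by (simp add: rips_magnitude_fun_insert_greatest)
qed simp

text \<open>For nonempty \<open>A\<close>, the point \<beta> splits the last gap in two, which
  replaces the contribution \<open>1 - u * v\<close> by \<open>(1 - u) + (1 - v)\<close>. The
  increase is \<open>(1 - u) * (1 - v)\<close>, a product of nonnegative factors.\<close>

lemma rips_magnitude_fun_le_insert_second:
  fixes A :: "real set"
  assumes "finite A" "\<And>a. a \<in> A \<Longrightarrow> a < \<beta>" "\<beta> < b" "t \<ge> 0"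
  shows "rips_magnitude_fun (insert b A) t \<le> rips_magnitude_fun (insert b (insert \<beta> A)) t"
proof (cases "A = {}")
  case True
  then show ?thesis
    using rips_magnitude_fun_le_insert_greatest[of "{\<beta>}" b t] assms by simp
next
  case False
  define a u v where "a = Max A" and "u = exp (- (\<beta> - a) * t)" and "v = exp (- (b - \<beta>) * t)"
  have a: "a < \<beta>" using assms False by (simp add: a_def)
  have "0 \<le> (\<beta> - a) * t" "0 \<le> (b - \<beta>) * t" using a assms by auto
  then have "u \<le> 1" "v \<le> 1"
    unfolding u_def v_def by (simp_all only: exp_le_one_iff mult_minus_left neg_le_0_iff_le)
  then have "0 \<le> (1 - u) * (1 - v)" by simp
  then have "1 - u * v \<le> (1 - u) + (1 - v)" by (simp add: algebra_simps)
  moreover have "u * v = exp (- (b - a) * t)"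
    by (simp add: u_def v_def mult_exp_exp algebra_simps)
  moreover have "rips_magnitude_fun (insert b A) t
      = rips_magnitude_fun A t + (1 - exp (- (b - a) * t))"
    unfolding a_def using assms False
    by (intro rips_magnitude_fun_insert_greatest) (auto intro: less_trans)
  moreover have "rips_magnitude_fun (insert \<beta> A) t = rips_magnitude_fun A t + (1 - u)"
    unfolding a_def u_def using assms False by (intro rips_magnitude_fun_insert_greatest) auto
  moreover have "rips_magnitude_fun (insert b (insert \<beta> A)) t
      = rips_magnitude_fun (insert \<beta> A) t + (1 - v)"
  proof -
    have "c < b" if "c \<in> insert \<beta> A" for c using that assms by (auto intro: less_trans)
    then have "rips_magnitude_fun (insert b (insert \<beta> A)) t
        = rips_magnitude_fun (insert \<beta> A) t + (1 - exp (- (b - Max (insert \<beta> A)) * t))"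
      using assms(1) by (intro rips_magnitude_fun_insert_greatest) auto
    moreover have "Max (insert \<beta> A) = \<beta>" using assms by (intro Max_insert_greatest)
    ultimately show ?thesis by (simp only: v_def)
  qed
  ultimately show ?thesis by linarith
qed

text \<open>The induction adjoins successive maxima to \<open>B\<close>. It keeps \<open>A\<close>
  arbitrary because, when \<open>b\<close> lies in \<open>A\<close>, the induction hypothesis is
  applied to a modification of \<open>A\<close> rather than to \<open>A\<close> itself.\<close>

lemma rips_magnitude_fun_mono:
  fixes A B :: "real set"
  assumes "finite B" "A \<subseteq> B" "t \<ge> 0"
  shows "rips_magnitude_fun A t \<le> rips_magnitude_fun B t"
  using assms(1,2)
proof (induction B arbitrary: A rule: finite_linorder_max_induct)
  case empty
  then show ?case by simp
next
  case (insert b B)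
  show ?case
  proof (cases "b \<in> A")
    case False
    then have "A \<subseteq> B" using insert.prems by auto
    then have "rips_magnitude_fun A t \<le> rips_magnitude_fun B t" by (rule insert.IH)
    also have "\<dots> \<le> rips_magnitude_fun (insert b B) t"
      using insert.hyps \<open>t \<ge> 0\<close> by (intro rips_magnitude_fun_le_insert_greatest) auto
    finally show ?thesis .
  next
    case True
    define C where "C = A - {b}"
    have C: "A = insert b C" "C \<subseteq> B" using True insert.prems by (auto simp: C_def)
    show ?thesis
    proof (cases "B = {}")
      case True
      then show ?thesis using C by simp
    next
      case False
      \<comment> \<open>Adjoining the predecessor \<beta> of \<open>b\<close> to \<open>C\<close>
        can only increase the magnitude. Afterwards both sets end with the same gap
        \<open>b - \<beta>\<close>, so its contribution is common to both sides and the comparison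
        reduces to \<open>insert \<beta> C\<close> inside \<open>B\<close>.\<close>
      define \<beta> where "\<beta> = Max B"
      have \<beta>: "\<beta> \<in> B" "\<beta> < b" using False insert.hyps by (auto simp: \<beta>_def)
      have finC: "finite C" using C insert.hyps finite_subset by auto
      have C_le: "c \<le> \<beta>" if "c \<in> C" for c using that C insert.hyps by (auto simp: \<beta>_def)
      have "rips_magnitude_fun A t \<le> rips_magnitude_fun (insert b (insert \<beta> C)) t"
      proof (cases "\<beta> \<in> C")
        case True
        then show ?thesis using C by (simp add: insert_absorb)
      next
        case False
        then have "c < \<beta>" if "c \<in> C" for c
          using that C_le by (auto simp: order.strict_iff_order)
        then show ?thesis
          using C(1) finC \<beta> \<open>t \<ge> 0\<close> by (simp add: rips_magnitude_fun_le_insert_second)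
      qed
      also have "\<dots> = rips_magnitude_fun (insert \<beta> C) t + (1 - exp (- (b - \<beta>) * t))"
      proof -
        have "Max (insert \<beta> C) = \<beta>" using finC C_le by (intro Max_eqI) auto
        moreover have "c < b" if "c \<in> insert \<beta> C" for c
          using that C_le \<beta> by (auto intro: le_less_trans)
        ultimately show ?thesis
          using rips_magnitude_fun_insert_greatest[of "insert \<beta> C" b t] finC by simp
      qed
      also have "\<dots> \<le> rips_magnitude_fun B t + (1 - exp (- (b - \<beta>) * t))"
        using insert.IH[of "insert \<beta> C"] C \<beta> by simp
      also have "\<dots> = rips_magnitude_fun (insert b B) t"
        using rips_magnitude_fun_insert_greatest[of B b t] insert.hyps False
        by (simp add: \<beta>_def)
      finally show ?thesis .
    qed
  qed
qed

section \<open>Bounds by total length and largest gap\<close>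

lemma rips_magnitude_fun_le_diameter:
  fixes A :: "real set"
  assumes "finite A" "A \<noteq> {}"
  shows "rips_magnitude_fun A t \<le> 1 + (Max A - Min A) * t"
  using assms
proof (induction A rule: finite_linorder_max_induct)
  case (insert b A)
  show ?case
  proof (cases "A = {}")
    case False
    define m where "m = Max A"
    have m: "m < b" "Min A \<le> m" using False insert.hyps by (auto simp: m_def)
    have "1 - (b - m) * t \<le> exp (- (b - m) * t)"
      using exp_ge_add_one_self[of "- (b - m) * t"] by (simp only: mult_minus_left)
    moreover have "rips_magnitude_fun (insert b A) t
        = rips_magnitude_fun A t + (1 - exp (- (b - m) * t))"
      unfolding m_def using insert.hyps False by (intro rips_magnitude_fun_insert_greatest) auto
    moreover have "rips_magnitude_fun A t \<le> 1 + (m - Min A) * t"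
      using insert.IH False by (simp add: m_def)
    moreover have "Max (insert b A) = b" "Min (insert b A) = Min A"
      using insert.hyps False by (auto intro!: Max_insert_greatest Min_insert_greatest)
    ultimately show ?thesis by (simp add: algebra_simps)
  qed simp
qed simp

lemma one_minus_exp_minus_ge:
  fixes x :: real
  assumes "x \<ge> 0"
  shows "x - x\<^sup>2 \<le> 1 - exp (- x)"
proof -
  have "exp (- x) \<le> inverse (1 + x)"
    using assms exp_ge_add_one_self[of x] by (simp add: exp_minus le_imp_inverse_le)
  \<comment> \<open>This holds because (1 + x)(1 - x + x^2) = 1 + x^3.\<close>
  also have "\<dots> \<le> 1 - x + x\<^sup>2"
    using assms by (simp add: field_simps power2_eq_square)
  finally show ?thesis by simp
qed

text \<open>A gap d \<le> h contributes at least d t - d^2 t^2 \<ge> d (t - h t^2), and the gaps add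
  up to \<open>Max A - Min A\<close>. Asking for some point of \<open>A\<close> at most
  \<open>h\<close> below each non-minimal point bounds all gaps without enumerating
  \<open>A\<close>, in a form that survives removal of the maximum.\<close>

lemma rips_magnitude_fun_ge_gap:
  fixes A :: "real set"
  assumes "finite A" "A \<noteq> {}"
    and "\<And>y. y \<in> A \<Longrightarrow> y \<noteq> Min A \<Longrightarrow> \<exists>x\<in>A. x < y \<and> y - x \<le> h"
    and "t \<ge> 0"
  shows "1 + (Max A - Min A) * (t - h * t\<^sup>2) \<le> rips_magnitude_fun A t"
  using assms(1-3)
proof (induction A rule: finite_linorder_max_induct)
  case (insert b A)
  show ?case
  proof (cases "A = {}")
    case False
    define m where "m = Max A"
    have m: "m < b" "Min A \<le> m" "m \<in> A" using False insert.hyps by (auto simp: m_def)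
    have Maxb: "Max (insert b A) = b" and Minb: "Min (insert b A) = Min A"
      using insert.hyps False by (auto intro!: Max_insert_greatest Min_insert_greatest)
    \<comment> \<open>The witness for \<open>y\<close> lies below \<open>y\<close>, hence below
      \<open>b\<close>, so it is still available in \<open>A\<close>.\<close>
    have "\<exists>x\<in>A. x < y \<and> y - x \<le> h" if "y \<in> A" "y \<noteq> Min A" for y
      using insert.prems(2)[of y] that Minb insert.hyps(2) by fastforce
    then have IH: "1 + (m - Min A) * (t - h * t\<^sup>2) \<le> rips_magnitude_fun A t"
      using insert.IH False by (simp add: m_def)
    obtain x where "x \<in> insert b A" "x < b" "b - x \<le> h"
      using insert.prems(2)[of b] Minb m by auto
    moreover from this have "x \<le> m" using insert.hyps by (auto simp: m_def)
    ultimately have h: "b - m \<le> h" by simp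
    have "(b - m) * (b - m) \<le> (b - m) * h" using h m by (intro mult_left_mono) auto
    then have "(b - m) * (b - m) * t\<^sup>2 \<le> (b - m) * h * t\<^sup>2" by (rule mult_right_mono) simp
    moreover have "(b - m) * t - ((b - m) * t)\<^sup>2 \<le> 1 - exp (- (b - m) * t)"
      using one_minus_exp_minus_ge[of "(b - m) * t"] m \<open>t \<ge> 0\<close>
      by (simp only: mult_minus_left) simp
    ultimately have "(b - m) * (t - h * t\<^sup>2) \<le> 1 - exp (- (b - m) * t)"
      by (simp add: power2_eq_square algebra_simps)
    moreover have "rips_magnitude_fun (insert b A) t
        = rips_magnitude_fun A t + (1 - exp (- (b - m) * t))"
      unfolding m_def using insert.hyps False by (intro rips_magnitude_fun_insert_greatest) auto
    ultimately show ?thesis using IH Maxb Minb by (simp add: algebra_simps)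
  qed simp
qed simp

section \<open>Hausdorff distance and finite approximation\<close>

lemma hausdorff_dist_lessE:
  assumes "hausdorff_dist A S < ennreal \<delta>" "s \<in> S"
  obtains a where "a \<in> A" "dist a s < \<delta>"
proof -
  have "(INF a\<in>A. ennreal (dist a s)) \<le> hausdorff_dist A S"
    unfolding hausdorff_dist_def using assms(2) by (auto intro: SUP_upper max.coboundedI2)
  then have "(INF a\<in>A. ennreal (dist a s)) < ennreal \<delta>" using assms(1) by simp
  then obtain a where "a \<in> A" "ennreal (dist a s) < ennreal \<delta>" by (auto simp: INF_less_iff)
  then show ?thesis using that by (simp add: ennreal_less_iff)
qed

lemma hausdorff_dist_le:
  assumes "A \<subseteq> S" "\<And>s. s \<in> S \<Longrightarrow> \<exists>a\<in>A. dist a s \<le> e"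
  shows "hausdorff_dist A S \<le> ennreal e"
proof -
  \<comment> \<open>The point \<open>a\<close> itself belongs to \<open>S\<close>, at distance
    0.\<close>
  have "(INF s\<in>S. ennreal (dist a s)) \<le> ennreal e" if "a \<in> A" for a
    using that assms(1) by (intro INF_lower2[of a]) auto
  moreover have "(INF a\<in>A. ennreal (dist a s)) \<le> ennreal e" if "s \<in> S" for s
    using assms(2)[OF that] by (auto intro: INF_lower2 ennreal_leI)
  ultimately show ?thesis
    unfolding hausdorff_dist_def by (auto intro: SUP_least)
qed

text \<open>Total boundedness gives a finite net. Radius \<open>\<delta> / 2\<close> keeps the final
  inequality strict, since a supremum of distances below a bound may equal that bound. These nets
  later show that the supremum reaches \<open>1 + t\<close>.\<close>

lemma compact_ex_finite_hausdorff_close: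
  fixes S :: "'a::metric_space set"
  assumes "compact S" "\<delta> > 0"
  obtains A where "finite A" "A \<subseteq> S" "hausdorff_dist A S < ennreal \<delta>"
proof -
  obtain A where A: "finite A" "A \<subseteq> S" "S \<subseteq> (\<Union>x\<in>A. ball x (\<delta> / 2))"
    using seq_compact_imp_totally_bounded[of S] assms
    by (metis compact_imp_seq_compact half_gt_zero)
  have "hausdorff_dist A S \<le> ennreal (\<delta> / 2)"
    using A by (intro hausdorff_dist_le) (force simp: subset_iff)+
  also have "\<dots> < ennreal \<delta>" using assms(2) by (simp add: ennreal_less_iff)
  finally show ?thesis using that A by blast
qed

section \<open>Finite subsets of the unit interval\<close>

lemma rips_magnitude_fun_unit_interval_le:
  fixes A :: "real set"
  assumes "finite A" "A \<subseteq> {0..1}" "t \<ge> 0"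
  shows "rips_magnitude_fun A t \<le> 1 + t"
proof (cases "A = {}")
  case False
  then have "Max A \<in> {0..1}" "Min A \<in> {0..1}" using assms Max_in Min_in by blast+
  then have "(Max A - Min A) * t \<le> 1 * t" using assms by (intro mult_right_mono) auto
  then show ?thesis using rips_magnitude_fun_le_diameter[of A t] assms False by simp
qed (use assms in simp)

text \<open>Points of \<open>A\<close> within \<delta> of 0 and of 1 make its length at least
  \<open>1 - 2 * \<delta>\<close>, and no gap exceeds \<open>2 * \<delta>\<close>, because the
  midpoint of a gap must also be close to \<open>A\<close>. The gap bound then applies with
  \<open>h = 2 * \<delta>\<close>.\<close>

lemma rips_magnitude_fun_unit_interval_ge:
  fixes A :: "real set"
  assumes "finite A" "A \<subseteq> {0..1}" "hausdorff_dist A {0..1} < ennreal \<delta>" "t \<ge> 0"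
  shows "1 + t - 2 * \<delta> * (t + t\<^sup>2) \<le> rips_magnitude_fun A t"
proof -
  have near: "\<exists>a\<in>A. \<bar>a - s\<bar> < \<delta>" if "s \<in> {0..1}" for s
    using hausdorff_dist_lessE[OF assms(3) that] by (auto simp: dist_real_def)
  \<comment> \<open>The infimum over an empty \<open>A\<close> would be \<infinity>, so closeness to
    the interval rules that case out.\<close>
  have ne: "A \<noteq> {}" using near[of 0] by auto
  have "\<delta> > 0" using near[of 0] by auto
  have gap: "\<exists>x\<in>A. x < y \<and> y - x \<le> 2 * \<delta>" if "y \<in> A" "y \<noteq> Min A" for y
  proof -
    define L where "L = {x \<in> A. x < y}"
    have "Min A < y" using that assms(1) by (simp add: order.strict_iff_order)
    moreover have "Min A \<in> A" using assms(1) ne by simp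
    ultimately have L: "finite L" "L \<noteq> {}" using assms(1) by (auto simp: L_def)
    define p where "p = Max L"
    have p: "p \<in> A" "p < y" using Max_in[OF L] by (auto simp: p_def L_def)
    \<comment> \<open>As \<open>p\<close> is the greatest point of \<open>A\<close> below
      \<open>y\<close>, no point of \<open>A\<close> is closer to this midpoint than half the
      gap.\<close>
    have "(p + y) / 2 \<in> {0..1}" using p that assms(2) by (auto simp: subset_iff)
    then obtain a where a: "a \<in> A" "\<bar>a - (p + y) / 2\<bar> < \<delta>" using near by blast
    have "a \<le> p \<or> y \<le> a"
    proof (cases "a < y")
      case True
      then show ?thesis using a L by (simp add: p_def L_def)
    qed simp
    then have "y - p \<le> 2 * \<delta>" using a p by (auto simp: abs_less_iff field_simps)
    then show ?thesis using p by blast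
  qed
  define l where "l = Max A - Min A"
  obtain a0 where a0: "a0 \<in> A" "a0 < \<delta>" using near[of 0] by auto
  obtain a1 where a1: "a1 \<in> A" "1 - \<delta> < a1" using near[of 1] by force
  have "Min A \<le> a0" "a1 \<le> Max A" using assms(1) a0 a1 by auto
  then have l_ge: "1 - 2 * \<delta> \<le> l" using a0 a1 by (simp add: l_def)
  have "Max A \<in> {0..1}" "Min A \<in> {0..1}" using assms ne Max_in Min_in by blast+
  then have l_le: "l \<le> 1" by (simp add: l_def)
  \<comment> \<open>The factor \<open>t - 2 * \<delta> * t\<^sup>2\<close> may be negative, so its
    two terms are estimated separately: the lower bound on \<open>l\<close> serves the linear term,
    the upper bound the quadratic one.\<close>
  have "(1 - 2 * \<delta>) * t \<le> l * t" using l_ge assms(4) by (rule mult_right_mono)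
  moreover have "l * (2 * \<delta> * t\<^sup>2) \<le> 1 * (2 * \<delta> * t\<^sup>2)"
    using l_le \<open>\<delta> > 0\<close> by (intro mult_right_mono) auto
  moreover have "1 + l * (t - 2 * \<delta> * t\<^sup>2) \<le> rips_magnitude_fun A t"
    unfolding l_def using assms ne gap by (intro rips_magnitude_fun_ge_gap)
  ultimately show ?thesis by (simp add: algebra_simps)
qed

lemma rips_magnitude_fun_unit_interval_uniform:
  fixes K :: "real set"
  assumes "bounded K" "K \<subseteq> {0<..}" "\<epsilon> > 0"
  obtains \<delta> where "\<delta> > 0"
    "\<And>(A :: real set) t. \<lbrakk>finite A; A \<subseteq> {0..1}; hausdorff_dist A {0..1} < ennreal \<delta>; t \<in> K\<rbrakk>
      \<Longrightarrow> \<bar>rips_magnitude_fun A t - (1 + t)\<bar> < \<epsilon>"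
proof -
  obtain T where T: "T > 0" "\<And>t. t \<in> K \<Longrightarrow> \<bar>t\<bar> \<le> T"
    using assms(1) by (auto simp: bounded_pos)
  define W where "W = T + T\<^sup>2"
  have W: "W > 0" using T by (simp add: W_def add_pos_pos)
  \<comment> \<open>On \<open>K\<close> the error \<open>2 * \<delta> * (t + t\<^sup>2)\<close> is
    at most \<open>2 * \<delta> * W\<close>, which this choice makes equal to
    \<open>\<epsilon> / 2\<close>.\<close>
  define \<delta> where "\<delta> = \<epsilon> / (4 * W)"
  have \<delta>: "\<delta> > 0" "2 * \<delta> * W < \<epsilon>" using assms(3) W by (simp_all add: \<delta>_def)
  have "\<bar>rips_magnitude_fun A t - (1 + t)\<bar> < \<epsilon>"
    if A: "finite A" "A \<subseteq> {0..1}" "hausdorff_dist A {0..1} < ennreal \<delta>" and "t \<in> K"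
    for A :: "real set" and t
  proof -
    have t: "0 < t" "t \<le> T" using \<open>t \<in> K\<close> T(2)[of t] assms(2) by auto
    then have "t + t\<^sup>2 \<le> W" unfolding W_def by (intro add_mono power_mono) auto
    then have "2 * \<delta> * (t + t\<^sup>2) \<le> 2 * \<delta> * W" using \<delta>(1) by (intro mult_left_mono) auto
    then show ?thesis
      using rips_magnitude_fun_unit_interval_ge[OF A, of t]
        rips_magnitude_fun_unit_interval_le[OF A(1,2), of t] t \<delta>(2)
      by simp
  qed
  with \<delta>(1) show ?thesis by (rule that)
qed

theorem theorem9p1:
  fixes I :: "real set"
  assumes "I = {0..1}"
  shows "(\<forall>A B. finite A \<and> finite B \<and> A \<subseteq> I \<and> B \<subseteq> I \<and> A \<subseteq> B \<longrightarrow>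
            rips_magnitude A \<le> rips_magnitude B) \<and>
         (\<forall>t>0. bdd_above {rips_magnitude_fun A t | A. A \<subseteq> I \<and> finite A} \<and>
            Sup {rips_magnitude_fun A t | A. A \<subseteq> I \<and> finite A} = 1 + t) \<and>
         (\<forall>t>0. ((\<lambda>A. rips_magnitude_fun A t) \<longlongrightarrow> 1 + t) (finite_subsets_to I)) \<and>
         (\<forall>K \<epsilon>. compact K \<and> K \<subseteq> {0<..} \<and> \<epsilon> > 0 \<longrightarrow>
            (\<exists>\<delta>>0. \<forall>A. finite A \<and> A \<subseteq> I \<and> hausdorff_dist A I < ennreal \<delta> \<longrightarrow>
               (\<forall>t\<in>K. \<bar>rips_magnitude_fun A t - (1 + t)\<bar> < \<epsilon>)))"
proof -
  have mono: "\<forall>A B. finite A \<and> finite B \<and> A \<subseteq> I \<and> B \<subseteq> I \<and> A \<subseteq> B \<longrightarrow>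
      rips_magnitude A \<le> rips_magnitude B"
    by (simp add: rips_magnitude_def rips_magnitude_fun_mono)
  have unif: "\<exists>\<delta>>0. \<forall>A. finite A \<and> A \<subseteq> I \<and> hausdorff_dist A I < ennreal \<delta> \<longrightarrow>
      (\<forall>t\<in>K. \<bar>rips_magnitude_fun A t - (1 + t)\<bar> < \<epsilon>)"
    if "bounded K" "K \<subseteq> {0<..}" "\<epsilon> > 0" for K and \<epsilon> :: real
    using rips_magnitude_fun_unit_interval_uniform[OF that] unfolding assms by (metis (no_types, lifting))
  \<comment> \<open>The case of the one-point set \<open>{t}\<close> yields both the pointwise limit
    and the lower bound for the supremum.\<close>
  have ptw: "\<exists>\<delta>>0. \<forall>A. finite A \<and> A \<subseteq> I \<and> hausdorff_dist A I < ennreal \<delta> \<longrightarrow>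
      \<bar>rips_magnitude_fun A t - (1 + t)\<bar> < \<epsilon>" if "t > 0" "\<epsilon> > 0" for t \<epsilon> :: real
    using unif[of "{t}" \<epsilon>] that by simp
  have lim: "((\<lambda>A. rips_magnitude_fun A t) \<longlongrightarrow> 1 + t) (finite_subsets_to I)" if t: "t > 0" for t
  proof (rule tendstoI)
    fix \<epsilon> :: real assume "\<epsilon> > 0"
    from ptw[OF t this] obtain \<delta> where "\<delta> > 0" "\<forall>A. finite A \<and> A \<subseteq> I \<and> hausdorff_dist A I < ennreal \<delta> \<longrightarrow>
        \<bar>rips_magnitude_fun A t - (1 + t)\<bar> < \<epsilon>" by (elim exE conjE)
    then show "\<forall>\<^sub>F A in finite_subsets_to I. dist (rips_magnitude_fun A t) (1 + t) < \<epsilon>"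
      unfolding finite_subsets_to_def
      by (intro eventually_INF1[of \<delta>]) (auto simp: eventually_principal dist_real_def)
  qed
  have sup: "bdd_above {rips_magnitude_fun A t | A. A \<subseteq> I \<and> finite A} \<and>
      Sup {rips_magnitude_fun A t | A. A \<subseteq> I \<and> finite A} = 1 + t" if t: "t > 0" for t
  proof
    let ?S = "{rips_magnitude_fun A t | A. A \<subseteq> I \<and> finite A}"
    have le: "x \<le> 1 + t" if "x \<in> ?S" for x
      using that t rips_magnitude_fun_unit_interval_le by (auto simp: assms)
    then show bdd: "bdd_above ?S" by (rule bdd_aboveI)
    show "Sup ?S = 1 + t"
    proof (rule antisym)
      show "Sup ?S \<le> 1 + t" using le by (intro cSup_least) auto
      show "1 + t \<le> Sup ?S"
      proof (rule field_le_epsilon)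
        fix \<epsilon> :: real assume "\<epsilon> > 0"
        from ptw[OF t this] obtain \<delta> where \<delta>: "\<delta> > 0"
          "\<forall>A. finite A \<and> A \<subseteq> I \<and> hausdorff_dist A I < ennreal \<delta> \<longrightarrow>
            \<bar>rips_magnitude_fun A t - (1 + t)\<bar> < \<epsilon>" by (elim exE conjE)
        \<comment> \<open>Closeness alone gives values near \<open>1 + t\<close>; compactness
          ensures that a finite set this close to \<open>I\<close> exists.\<close>
        have "compact I" by (simp add: assms)
        then obtain A where A: "finite A" "A \<subseteq> I" "hausdorff_dist A I < ennreal \<delta>"
          using \<delta>(1) by (rule compact_ex_finite_hausdorff_close)
        have "rips_magnitude_fun A t \<le> Sup ?S" using A bdd by (intro cSup_upper) auto
        moreover have "\<bar>rips_magnitude_fun A t - (1 + t)\<bar> < \<epsilon>" using \<delta>(2) A by simp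
        ultimately show "1 + t \<le> Sup ?S + \<epsilon>" by linarith
      qed
    qed
  qed
  show ?thesis
    by (intro conjI allI impI mono sup lim unif) (auto dest: compact_imp_bounded)
qed

end
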